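(* If $n$ is a nonnegative integer, then $$\widetilde{A}_n(t)=\sum_{k=0}^{\lfloor n/2\rfloor}\gamma_{nk}\,t^k(1+t)^{n-2k},$$ where $\gamma_{nk}$ is the number of permutations in $\mathfrak{S}_n$ with exactly $k$ excedances and no double excedances.
   Context: $\mathfrak{S}_n$ is the symmetric group on $[n]=\{1,\dots,n\}$. For $n\ge 0$, the $n$-th Eulerian polynomial is $A_n(t)=\sum_{k=0}^n A_{nk}t^k$, where $A_{nk}$ is the number of $\sigma\in\mathfrak{S}_n$ such that $\sigma(i)\ge i$ for exactly $k$ indices $i$ (so $A_0(t)=1$). The $n$-th binomial Eulerian polynomial is $\widetilde{A}_n(t)=\sum_{i=0}^n\binom{n}{i}A_i(t)$. For $\sigma\in\mathfrak{S}_n$, an element $i\in[n]$ is an excedance of $\sigma$ if $\sigma(i)>i$, and it is a double excedance of $\sigma$ if $\sigma(i)>i>\sigma^{-1}(i)$. *)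

theory Defs
  imports "HOL-Combinatorics.Permutations" "HOL-Computational_Algebra.Polynomial"
begin

text \<open>
  The symmetric group on \<open>[n]\<close> is the set of all \<open>\<sigma>\<close> with
  \<open>\<sigma> permutes {1..n}\<close>; such a function is the identity outside \<open>{1..n}\<close>, so all
  statistics below are taken over \<open>i \<in> {1..n}\<close> only.
\<close>

definition weak_excedances :: "nat \<Rightarrow> (nat \<Rightarrow> nat) \<Rightarrow> nat set" where
  "weak_excedances n \<sigma> = {i \<in> {1..n}. \<sigma> i \<ge> i}"

definition excedances :: "nat \<Rightarrow> (nat \<Rightarrow> nat) \<Rightarrow> nat set" where
  "excedances n \<sigma> = {i \<in> {1..n}. \<sigma> i > i}"

definition double_excedances :: "nat \<Rightarrow> (nat \<Rightarrow> nat) \<Rightarrow> nat set" where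
  "double_excedances n \<sigma> = {i \<in> {1..n}. \<sigma> i > i \<and> i > inv \<sigma> i}"

definition eulerian_number :: "nat \<Rightarrow> nat \<Rightarrow> nat" where
  "eulerian_number n k =
    card {\<sigma>. \<sigma> permutes {1..n} \<and> card (weak_excedances n \<sigma>) = k}"

text \<open>
  With weak excedances (rather than excedances or descents), \<open>A\<^sub>n\<close> is divisible
  by \<open>t\<close> for \<open>n \<ge> 1\<close>, and \<open>A\<^sub>0 = 1\<close>.
\<close>

definition eulerian_poly :: "nat \<Rightarrow> int poly" where
  "eulerian_poly n = (\<Sum>k=0..n. monom (int (eulerian_number n k)) k)"

definition binomial_eulerian_poly :: "nat \<Rightarrow> int poly" where
  "binomial_eulerian_poly n = (\<Sum>i=0..n. of_nat (n choose i) * eulerian_poly i)"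

definition gamma_coeff :: "nat \<Rightarrow> nat \<Rightarrow> nat" where
  "gamma_coeff n k =
    card {\<sigma>. \<sigma> permutes {1..n} \<and> card (excedances n \<sigma>) = k \<and> double_excedances n \<sigma> = {}}"

end

theory Submission
  imports Defs
begin

text \<open>
  Let \<open>p\<close>, \<open>u\<close>, \<open>v\<close>, \<open>f\<close> count the cyclic peaks, the double excedances, the double
  anti-excedances (\<open>\<sigma> i < i < \<sigma>\<^sup>-\<^sup>1 i\<close>) and the fixed points of a permutation of \<open>[n]\<close>. The
  remaining elements are the cyclic valleys. Each excedance arc ends in a peak or a double
  excedance, so there are \<open>p + u\<close> excedances, and \<open>2 p + u + v + f = n\<close>.

  Expanding \<open>(1 + t) ^ f\<close> chooses a set of fixed points; deleting the fixed points that are not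
  chosen leaves a permutation of a subset of \<open>[n]\<close>. Hence the binomial Eulerian polynomial is the
  sum of \<open>t ^ (p + u) * (1 + t) ^ f\<close> over all permutations. The gamma expansion is the sum of
  \<open>t ^ p * (1 + t) ^ (v + f)\<close> over those with \<open>u = 0\<close>. Both weights become
  \<open>t ^ p * (1 + t) ^ (s + f)\<close> when they are summed over \<open>u + v = s\<close> with binomial coefficients, as
  if each of the \<open>s\<close> elements were independently a double excedance or a double anti-excedance.
  It remains to justify this independence and the deletion of fixed points.

  Classically one lets a group of involutions hop the elements along the cycles, and relabels the
  support of a permutation. Here both facts are read off from one recurrence instead. Inserting
  \<open>n + 1\<close> into an arc of a permutation changes \<open>p, u, v, f\<close> in a way that depends only on the kind
  of the arc, so the sum of a weight \<open>g\<close> over permutations of \<open>[n + 1]\<close> is the sum over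
  permutations of \<open>[n]\<close> of a transformed weight (\<open>perm_sum_Suc\<close>). This transformation of weights
  descends to weights symmetrised over \<open>u + v\<close>, so a sum over permutations only sees the
  symmetrised weight (\<open>perm_sum_symmetrised_cong\<close>). It also interacts with the binomial transform
  in \<open>f\<close> exactly as required by Pascal's rule (\<open>binomial_sum_perm_sum\<close>).
\<close>

section \<open>Binomial sums\<close>

text \<open>
  The second argument \<open>s - i\<close> of \<open>h\<close> is redundant, but makes the operator symmetric. The same
  operator distributes \<open>s\<close> elements over two kinds, chooses among the fixed points, and sums the
  Eulerian polynomials.
\<close>

definition binomial_sum :: "nat \<Rightarrow> (nat \<Rightarrow> nat \<Rightarrow> 'a::comm_semiring_1) \<Rightarrow> 'a" where
  "binomial_sum s h = (\<Sum>i\<le>s. of_nat (s choose i) * h i (s - i))"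

lemma binomial_sum_0 [simp]: "binomial_sum 0 h = h 0 0"
  by (simp add: binomial_sum_def)

lemma binomial_sum_add:
  "binomial_sum s (\<lambda>i j. h i j + k i j) = binomial_sum s h + binomial_sum s k"
  by (simp add: binomial_sum_def sum.distrib algebra_simps)

lemma binomial_sum_mult:
  "binomial_sum s (\<lambda>i j. c * h i j) = c * binomial_sum s h"
  by (simp add: binomial_sum_def sum_distrib_left mult_ac)

lemma binomial_sum_power:
  "binomial_sum s (\<lambda>i j. x ^ i * y ^ j) = (x + y) ^ s"
  by (simp add: binomial_sum_def binomial_ring mult_ac)

text \<open>
  Pascal's rule: the additional element is of the second or of the first kind.
\<close>

lemma binomial_sum_Suc:
  "binomial_sum (Suc s) h =
    binomial_sum s (\<lambda>i j. h i (Suc j)) + binomial_sum s (\<lambda>i j. h (Suc i) j)"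
proof -
  have "binomial_sum (Suc s) h =
      h 0 (Suc s) + (\<Sum>i\<le>s. of_nat (Suc s choose Suc i) * h (Suc i) (s - i))"
    by (simp add: binomial_sum_def sum.atMost_Suc_shift del: sum.atMost_Suc binomial_Suc_Suc)
  also have "\<dots> = (h 0 (Suc s) + (\<Sum>i\<le>s. of_nat (s choose Suc i) * h (Suc i) (s - i)))
      + binomial_sum s (\<lambda>i j. h (Suc i) j)"
    by (simp add: binomial_sum_def algebra_simps sum.distrib)
  also have "h 0 (Suc s) + (\<Sum>i\<le>s. of_nat (s choose Suc i) * h (Suc i) (s - i)) =
      (\<Sum>i\<le>Suc s. of_nat (s choose i) * h i (Suc s - i))"
    by (simp add: sum.atMost_Suc_shift del: sum.atMost_Suc)
  also have "\<dots> = binomial_sum s (\<lambda>i j. h i (Suc j))"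
    by (simp add: binomial_sum_def Suc_diff_le binomial_eq_0)
  finally show ?thesis .
qed

lemma binomial_sum_flip: "binomial_sum s h = binomial_sum s (\<lambda>i j. h j i)"
  unfolding binomial_sum_def
  by (rule sum.reindex_bij_witness[of _ "\<lambda>i. s - i" "\<lambda>i. s - i"])
     (auto simp: binomial_symmetric[symmetric])

text \<open>
  Selecting one of the \<open>i\<close> elements of the first kind and deleting it amounts to deleting one of
  all \<open>s\<close> elements and distributing the others.
\<close>

lemma binomial_sum_absorb_left:
  "binomial_sum s (\<lambda>i j. of_nat i * h (i - 1) j) = of_nat s * binomial_sum (s - 1) h"
proof (cases s)
  case (Suc r)
  have absorb: "of_nat (Suc r choose Suc i) * (of_nat (Suc i) * x) =
      of_nat (Suc r) * (of_nat (r choose i) * (x::'a))" for i x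
    using Suc_times_binomial[of i r]
    by (metis mult.assoc mult.commute of_nat_mult)
  have "binomial_sum s (\<lambda>i j. of_nat i * h (i - 1) j) =
      (\<Sum>i\<le>r. of_nat (Suc r choose Suc i) * (of_nat (Suc i) * h i (r - i)))"
    by (simp add: Suc binomial_sum_def sum.atMost_Suc_shift
        del: sum.atMost_Suc binomial_Suc_Suc of_nat_Suc)
  also have "\<dots> = of_nat s * binomial_sum (s - 1) h"
    unfolding absorb by (simp add: Suc binomial_sum_def sum_distrib_left)
  finally show ?thesis .
qed simp

lemma binomial_sum_absorb_right:
  "binomial_sum s (\<lambda>i j. of_nat j * h i (j - 1)) = of_nat s * binomial_sum (s - 1) h"
proof -
  have "binomial_sum s (\<lambda>i j. of_nat j * h i (j - 1)) =
      binomial_sum s (\<lambda>i j. of_nat i * h j (i - 1))"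
    by (rule binomial_sum_flip)
  also have "\<dots> = of_nat s * binomial_sum (s - 1) (\<lambda>i j. h j i)"
    by (rule binomial_sum_absorb_left)
  finally show ?thesis by (simp only: binomial_sum_flip[of "s - 1" "\<lambda>i j. h j i"])
qed

section \<open>Cyclic statistics of a permutation\<close>

definition cyclic_peaks :: "nat \<Rightarrow> (nat \<Rightarrow> nat) \<Rightarrow> nat set" where
  "cyclic_peaks n \<sigma> = {i \<in> {1..n}. \<sigma> i < i \<and> inv \<sigma> i < i}"

definition double_anti_excedances :: "nat \<Rightarrow> (nat \<Rightarrow> nat) \<Rightarrow> nat set" where
  "double_anti_excedances n \<sigma> = {i \<in> {1..n}. \<sigma> i < i \<and> i < inv \<sigma> i}"

definition fixed_points :: "nat \<Rightarrow> (nat \<Rightarrow> nat) \<Rightarrow> nat set" where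
  "fixed_points n \<sigma> = {i \<in> {1..n}. \<sigma> i = i}"

lemmas cyclic_stat_defs =
  cyclic_peaks_def double_excedances_def double_anti_excedances_def fixed_points_def

lemma finite_cyclic_stats [simp]:
  "finite (cyclic_peaks n \<sigma>)" "finite (double_excedances n \<sigma>)"
  "finite (double_anti_excedances n \<sigma>)" "finite (fixed_points n \<sigma>)"
  by (simp_all add: cyclic_stat_defs)

context
  fixes n :: nat and \<sigma> :: "nat \<Rightarrow> nat"
  assumes perm: "\<sigma> permutes {1..n}"
begin

lemma inv_eq_self_iff: "inv \<sigma> i = i \<longleftrightarrow> \<sigma> i = i"
  by (metis perm permutes_inv_eq)

text \<open>
  The target \<open>j\<close> of an arc that ascends satisfies \<open>\<sigma>\<^sup>-\<^sup>1 j < j\<close>, and the next arc decides between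
  peak and double excedance.
\<close>

lemma image_excedances: "\<sigma> ` excedances n \<sigma> = cyclic_peaks n \<sigma> \<union> double_excedances n \<sigma>"
proof (intro equalityI subsetI)
  fix j assume "j \<in> cyclic_peaks n \<sigma> \<union> double_excedances n \<sigma>"
  then have j: "j \<in> {1..n}" "inv \<sigma> j < j" by (auto simp: cyclic_stat_defs)
  moreover have "inv \<sigma> j \<in> {1..n}"
    using j(1) permutes_in_image[OF permutes_inv[OF perm]] by blast
  ultimately have "inv \<sigma> j \<in> excedances n \<sigma>"
    by (simp add: excedances_def permutes_inverses[OF perm])
  then show "j \<in> \<sigma> ` excedances n \<sigma>"
    by (rule rev_image_eqI) (simp add: permutes_inverses[OF perm])
next
  fix j assume "j \<in> \<sigma> ` excedances n \<sigma>"
  then obtain i where i: "i \<in> {1..n}" "i < \<sigma> i" "j = \<sigma> i" by (auto simp: excedances_def)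
  moreover have "\<sigma> i \<in> {1..n}" using i(1) permutes_in_image[OF perm] by blast
  moreover have "\<sigma> (\<sigma> i) \<noteq> \<sigma> i" using i(2) permutes_inj[OF perm] by (metis injD less_irrefl)
  ultimately show "j \<in> cyclic_peaks n \<sigma> \<union> double_excedances n \<sigma>"
    by (auto simp: cyclic_stat_defs permutes_inverses[OF perm])
qed

lemma card_excedances:
  "card (excedances n \<sigma>) = card (cyclic_peaks n \<sigma>) + card (double_excedances n \<sigma>)"
proof -
  have "card (excedances n \<sigma>) = card (\<sigma> ` excedances n \<sigma>)"
    using permutes_inj[OF perm] by (simp add: card_image inj_on_subset[OF _ subset_UNIV])
  also have "\<dots> = card (cyclic_peaks n \<sigma> \<union> double_excedances n \<sigma>)"
    by (simp only: image_excedances)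
  also have "\<dots> = card (cyclic_peaks n \<sigma>) + card (double_excedances n \<sigma>)"
    by (rule card_Un_disjoint) (auto simp: cyclic_stat_defs)
  finally show ?thesis .
qed

lemma anti_excedances_eq:
  "{i \<in> {1..n}. \<sigma> i < i} = cyclic_peaks n \<sigma> \<union> double_anti_excedances n \<sigma>"
proof -
  have "\<sigma> i < i \<Longrightarrow> inv \<sigma> i < i \<or> i < inv \<sigma> i" for i
    using inv_eq_self_iff[of i] by linarith
  then show ?thesis by (auto simp: cyclic_stat_defs)
qed

lemma card_weak_excedances:
  "card (weak_excedances n \<sigma>) = card (excedances n \<sigma>) + card (fixed_points n \<sigma>)"
proof -
  have "weak_excedances n \<sigma> = excedances n \<sigma> \<union> fixed_points n \<sigma>"
    by (auto simp: weak_excedances_def excedances_def fixed_points_def)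
  then show ?thesis
    by (simp add: card_Un_disjoint excedances_def fixed_points_def disjoint_iff)
qed

text \<open>
  Each arc ascends, descends or is a loop. The ascending arcs are counted by their targets, the
  descending ones by their sources; the peaks are counted in both.
\<close>

lemma cyclic_stats_sum:
  "2 * card (cyclic_peaks n \<sigma>) + card (double_excedances n \<sigma>)
    + card (double_anti_excedances n \<sigma>) + card (fixed_points n \<sigma>) = n"
proof -
  have "{1..n} = weak_excedances n \<sigma> \<union> {i \<in> {1..n}. \<sigma> i < i}"
    by (auto simp: weak_excedances_def)
  then have "n = card (weak_excedances n \<sigma> \<union> {i \<in> {1..n}. \<sigma> i < i})"
    by (metis card_atLeastAtMost diff_Suc_1)
  also have "\<dots> = card (weak_excedances n \<sigma>) + card {i \<in> {1..n}. \<sigma> i < i}"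
    by (rule card_Un_disjoint) (auto simp: weak_excedances_def)
  also have "card {i \<in> {1..n}. \<sigma> i < i} =
      card (cyclic_peaks n \<sigma>) + card (double_anti_excedances n \<sigma>)"
    unfolding anti_excedances_eq by (rule card_Un_disjoint) (auto simp: cyclic_stat_defs)
  finally show ?thesis by (simp add: card_weak_excedances card_excedances)
qed

end

section \<open>Inserting the largest element\<close>

text \<open>
  The arc from \<open>a\<close> to \<open>\<sigma> a\<close> is replaced by the path from \<open>a\<close> through \<open>n + 1\<close> to \<open>\<sigma> a\<close>.
\<close>

definition insert_max :: "nat \<Rightarrow> nat \<Rightarrow> (nat \<Rightarrow> nat) \<Rightarrow> nat \<Rightarrow> nat" where
  "insert_max n a \<sigma> = transpose (Suc n) (\<sigma> a) \<circ> \<sigma>"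

lemma atLeastAtMost_Suc_insert: "{1..Suc n} = insert (Suc n) {1..n}"
  by auto

context
  fixes n :: nat and \<sigma> :: "nat \<Rightarrow> nat" and a :: nat
  assumes perm: "\<sigma> permutes {1..n}" and a: "a \<in> {1..n}"
begin

lemma insert_max_permutes: "insert_max n a \<sigma> permutes {1..Suc n}"
proof -
  have "\<sigma> a \<in> {1..n}" using a permutes_in_image[OF perm] by blast
  then have "transpose (Suc n) (\<sigma> a) permutes {1..Suc n}"
    by (intro permutes_swap_id) auto
  moreover have "\<sigma> permutes {1..Suc n}"
    by (rule permutes_subset[OF perm]) auto
  ultimately show ?thesis unfolding insert_max_def by (intro permutes_compose)
qed

lemma insert_max_apply:
  "insert_max n a \<sigma> i = (if i = a then Suc n else if i = Suc n then \<sigma> a else \<sigma> i)"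
proof -
  have fix_max: "\<sigma> (Suc n) = Suc n" by (rule permutes_not_in[OF perm]) simp
  have eq_iff: "\<sigma> i = \<sigma> j \<longleftrightarrow> i = j" for j
    using permutes_inj[OF perm] by (auto dest: injD)
  show ?thesis
    using a eq_iff[of a] eq_iff[of "Suc n"] fix_max
    by (simp add: insert_max_def transpose_def)
qed

lemma inv_insert_max_apply:
  "inv (insert_max n a \<sigma>) i =
    (if i = \<sigma> a then Suc n else if i = Suc n then a else inv \<sigma> i)"
proof -
  have fix_max: "\<sigma> (Suc n) = Suc n" by (rule permutes_not_in[OF perm]) simp
  show ?thesis
    unfolding permutes_inv_eq[OF insert_max_permutes] insert_max_apply
    using a fix_max permutes_inv_eq[OF perm, of i] permutes_inverses[OF perm]
    by auto
qed

text \<open>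
  The next three lemmas use that \<open>n + 1\<close> becomes a peak and that only \<open>a\<close> and \<open>\<sigma> a\<close> can change
  their kind: \<open>a\<close> now has a larger successor and \<open>\<sigma> a\<close> a larger predecessor. A fixed point
  \<open>a\<close> becomes a valley.
\<close>

lemma fixed_insert_stats:
  assumes "\<sigma> a = a"
  shows "cyclic_peaks (Suc n) (insert_max n a \<sigma>) = insert (Suc n) (cyclic_peaks n \<sigma>)"
    and "double_excedances (Suc n) (insert_max n a \<sigma>) = double_excedances n \<sigma>"
    and "double_anti_excedances (Suc n) (insert_max n a \<sigma>) = double_anti_excedances n \<sigma>"
    and "fixed_points (Suc n) (insert_max n a \<sigma>) = fixed_points n \<sigma> - {a}"
  using a assms unfolding cyclic_stat_defs atLeastAtMost_Suc_insert
  by (auto simp: insert_max_apply inv_insert_max_apply split: if_splits)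

text \<open>
  On an ascending arc only the target changes: a peak becomes a double anti-excedance, and a double
  excedance becomes a valley.
\<close>

lemma excedance_insert_stats:
  assumes "a < \<sigma> a"
  shows "cyclic_peaks (Suc n) (insert_max n a \<sigma>) = insert (Suc n) (cyclic_peaks n \<sigma> - {\<sigma> a})"
    and "double_excedances (Suc n) (insert_max n a \<sigma>) = double_excedances n \<sigma> - {\<sigma> a}"
    and "double_anti_excedances (Suc n) (insert_max n a \<sigma>) =
      double_anti_excedances n \<sigma> \<union> ({\<sigma> a} \<inter> cyclic_peaks n \<sigma>)"
    and "fixed_points (Suc n) (insert_max n a \<sigma>) = fixed_points n \<sigma>"
  using a assms permutes_in_image[OF perm, of a] permutes_inverses[OF perm] inv_eq_self_iff[OF perm]
  unfolding cyclic_stat_defs atLeastAtMost_Suc_insert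
  by (auto simp: insert_max_apply inv_insert_max_apply split: if_splits)

text \<open>
  On a descending arc only the source changes: a peak becomes a double excedance, and a double
  anti-excedance becomes a valley.
\<close>

lemma anti_excedance_insert_stats:
  assumes "\<sigma> a < a"
  shows "cyclic_peaks (Suc n) (insert_max n a \<sigma>) = insert (Suc n) (cyclic_peaks n \<sigma> - {a})"
    and "double_excedances (Suc n) (insert_max n a \<sigma>) =
      double_excedances n \<sigma> \<union> ({a} \<inter> cyclic_peaks n \<sigma>)"
    and "double_anti_excedances (Suc n) (insert_max n a \<sigma>) = double_anti_excedances n \<sigma> - {a}"
    and "fixed_points (Suc n) (insert_max n a \<sigma>) = fixed_points n \<sigma>"
  using a assms permutes_in_image[OF perm, of a] permutes_inverses[OF perm] inv_eq_self_iff[OF perm]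
  unfolding cyclic_stat_defs atLeastAtMost_Suc_insert
  by (auto simp: insert_max_apply inv_insert_max_apply split: if_splits)

end

section \<open>The recurrence for sums over the symmetric group\<close>

definition weigh :: "(nat \<Rightarrow> nat \<Rightarrow> nat \<Rightarrow> nat \<Rightarrow> 'a) \<Rightarrow> nat \<Rightarrow> (nat \<Rightarrow> nat) \<Rightarrow> 'a" where
  "weigh g n \<sigma> = g (card (cyclic_peaks n \<sigma>)) (card (double_excedances n \<sigma>))
    (card (double_anti_excedances n \<sigma>)) (card (fixed_points n \<sigma>))"

definition perm_sum ::
    "nat \<Rightarrow> (nat \<Rightarrow> nat \<Rightarrow> nat \<Rightarrow> nat \<Rightarrow> 'a::comm_semiring_1) \<Rightarrow> 'a" where
  "perm_sum n g = (\<Sum>\<sigma> | \<sigma> permutes {1..n}. weigh g n \<sigma>)"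

text \<open>
  The total weight of the permutations obtained by inserting \<open>n + 1\<close> into one with statistics
  \<open>p, u, v, f\<close>: as a new fixed point, into a loop, into an arc at a peak (the ascending
  arc to it or the descending arc from it), or into the ascending arc
  to a double excedance or the descending arc from a double anti-excedance. A truncated
  subtraction such as \<open>0 - 1\<close> occurs only with coefficient \<open>0\<close>.
\<close>

definition insertion_step ::
    "(nat \<Rightarrow> nat \<Rightarrow> nat \<Rightarrow> nat \<Rightarrow> 'a::comm_semiring_1) \<Rightarrow> nat \<Rightarrow> nat \<Rightarrow> nat \<Rightarrow> nat \<Rightarrow> 'a" where
  "insertion_step g p u v f = g p u v (Suc f) + of_nat f * g (Suc p) u v (f - 1)
    + of_nat p * (g p u (Suc v) f + g p (Suc u) v f)
    + of_nat u * g (Suc p) (u - 1) v f + of_nat v * g (Suc p) u (v - 1) f"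

lemma perm_sum_0 [simp]: "perm_sum 0 g = g 0 0 0 0"
  by (simp add: perm_sum_def weigh_def cyclic_stat_defs)

lemma perm_sum_add:
  "perm_sum n (\<lambda>p u v f. g p u v f + h p u v f) = perm_sum n g + perm_sum n h"
  by (simp add: perm_sum_def weigh_def sum.distrib)

lemma weigh_Suc_fixed:
  assumes "\<sigma> permutes {1..n}"
  shows "weigh g (Suc n) \<sigma> = g (card (cyclic_peaks n \<sigma>)) (card (double_excedances n \<sigma>))
    (card (double_anti_excedances n \<sigma>)) (Suc (card (fixed_points n \<sigma>)))"
proof -
  have "\<sigma> (Suc n) = Suc n" by (rule permutes_not_in[OF assms]) simp
  then have "cyclic_peaks (Suc n) \<sigma> = cyclic_peaks n \<sigma>"
    "double_excedances (Suc n) \<sigma> = double_excedances n \<sigma>"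
    "double_anti_excedances (Suc n) \<sigma> = double_anti_excedances n \<sigma>"
    "fixed_points (Suc n) \<sigma> = insert (Suc n) (fixed_points n \<sigma>)"
    by (auto simp: cyclic_stat_defs le_Suc_eq)
  moreover have "Suc n \<notin> fixed_points n \<sigma>" by (simp add: fixed_points_def)
  ultimately show ?thesis by (simp add: weigh_def)
qed

text \<open>
  The sum over \<open>a\<close> splits into loops, ascending and descending arcs. Ascending arcs are
  reindexed by their targets, so that each of the peaks occurs once as a target and once as the
  source of a descending arc.
\<close>

lemma sum_weigh_insert_max:
  fixes g :: "nat \<Rightarrow> nat \<Rightarrow> nat \<Rightarrow> nat \<Rightarrow> 'a::comm_semiring_1"
  assumes perm: "\<sigma> permutes {1..n}"
  shows "weigh g (Suc n) \<sigma> + (\<Sum>a\<in>{1..n}. weigh g (Suc n) (insert_max n a \<sigma>)) =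
    weigh (insertion_step g) n \<sigma>"
proof -
  let ?P = "cyclic_peaks n \<sigma>" and ?U = "double_excedances n \<sigma>"
    and ?V = "double_anti_excedances n \<sigma>" and ?F = "fixed_points n \<sigma>"
    and ?E = "excedances n \<sigma>" and ?D = "{i \<in> {1..n}. \<sigma> i < i}"
  define p u v f where "p = card ?P" and "u = card ?U" and "v = card ?V" and "f = card ?F"
  note puvf = p_def u_def v_def f_def
  let ?w = "\<lambda>a. weigh g (Suc n) (insert_max n a \<sigma>)"
  have max: "Suc n \<notin> ?P" by (simp add: cyclic_peaks_def)
  have disj: "?P \<inter> ?U = {}" "?P \<inter> ?V = {}" by (auto simp: cyclic_stat_defs)
  have card_peaks: "Suc (card ?P - Suc 0) = card ?P" if "i \<in> ?P" for i
    using that card_gt_0_iff[of ?P] by auto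
  have fixed: "?w a = g (Suc p) u v (f - 1)" if "a \<in> ?F" for a
  proof -
    have a: "a \<in> {1..n}" "\<sigma> a = a" using that by (auto simp: fixed_points_def)
    show ?thesis using that max by (simp add: weigh_def fixed_insert_stats[OF perm a] puvf)
  qed
  have exc: "?w a = (if \<sigma> a \<in> ?P then g p u (Suc v) f else g (Suc p) (u - 1) v f)"
    if "a \<in> ?E" for a
  proof -
    have a: "a \<in> {1..n}" "a < \<sigma> a" using that by (auto simp: excedances_def)
    have "\<sigma> a \<in> ?P \<union> ?U" using image_excedances[OF perm] that by blast
    then consider "\<sigma> a \<in> ?P" "\<sigma> a \<notin> ?U" "\<sigma> a \<notin> ?V" | "\<sigma> a \<notin> ?P" "\<sigma> a \<in> ?U"
      using disj by blast
    then show ?thesis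
      by cases (simp_all add: weigh_def excedance_insert_stats[OF perm a] puvf max
          card_peaks)
  qed
  have anti: "?w a = (if a \<in> ?P then g p (Suc u) v f else g (Suc p) u (v - 1) f)"
    if "a \<in> ?D" for a
  proof -
    have a: "a \<in> {1..n}" "\<sigma> a < a" using that by auto
    have "a \<in> ?P \<union> ?V" using anti_excedances_eq[OF perm] that by blast
    then consider "a \<in> ?P" "a \<notin> ?U" "a \<notin> ?V" | "a \<notin> ?P" "a \<in> ?V"
      using disj by blast
    then show ?thesis
      by cases (simp_all add: weigh_def anti_excedance_insert_stats[OF perm a] puvf max
          card_peaks)
  qed
  have "sum ?w ?E =
      (\<Sum>a\<in>?E. if \<sigma> a \<in> ?P then g p u (Suc v) f else g (Suc p) (u - 1) v f)"
    by (intro sum.cong refl exc)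
  also have "\<dots> = (\<Sum>b\<in>\<sigma> ` ?E. if b \<in> ?P then g p u (Suc v) f else g (Suc p) (u - 1) v f)"
    using permutes_inj[OF perm] by (subst sum.reindex) (auto intro: inj_on_subset)
  also have "\<dots> = (\<Sum>b\<in>?P. if b \<in> ?P then g p u (Suc v) f else g (Suc p) (u - 1) v f)
      + (\<Sum>b\<in>?U. if b \<in> ?P then g p u (Suc v) f else g (Suc p) (u - 1) v f)"
    unfolding image_excedances[OF perm] using disj by (intro sum.union_disjoint) auto
  also have "(\<Sum>b\<in>?U. if b \<in> ?P then g p u (Suc v) f else g (Suc p) (u - 1) v f) =
      (\<Sum>b\<in>?U. g (Suc p) (u - 1) v f)"
    using disj by (intro sum.cong) auto
  finally have sum_exc:
    "sum ?w ?E = of_nat p * g p u (Suc v) f + of_nat u * g (Suc p) (u - 1) v f"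
    by (simp add: puvf)
  have "sum ?w ?D = (\<Sum>a\<in>?D. if a \<in> ?P then g p (Suc u) v f else g (Suc p) u (v - 1) f)"
    by (intro sum.cong refl anti)
  also have "\<dots> = (\<Sum>b\<in>?P. if b \<in> ?P then g p (Suc u) v f else g (Suc p) u (v - 1) f)
      + (\<Sum>b\<in>?V. if b \<in> ?P then g p (Suc u) v f else g (Suc p) u (v - 1) f)"
    unfolding anti_excedances_eq[OF perm] using disj by (intro sum.union_disjoint) auto
  also have "(\<Sum>b\<in>?V. if b \<in> ?P then g p (Suc u) v f else g (Suc p) u (v - 1) f) =
      (\<Sum>b\<in>?V. g (Suc p) u (v - 1) f)"
    using disj by (intro sum.cong) auto
  finally have sum_anti:
    "sum ?w ?D = of_nat p * g p (Suc u) v f + of_nat v * g (Suc p) u (v - 1) f"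
    by (simp add: puvf)
  have "{1..n} = ?F \<union> (?E \<union> ?D)" by (auto simp: fixed_points_def excedances_def)
  then have "sum ?w {1..n} = sum ?w (?F \<union> (?E \<union> ?D))"
    by (rule arg_cong)
  also have "\<dots> = sum ?w ?F + sum ?w (?E \<union> ?D)"
    by (rule sum.union_disjoint) (auto simp: fixed_points_def excedances_def)
  also have "sum ?w (?E \<union> ?D) = sum ?w ?E + sum ?w ?D"
    by (rule sum.union_disjoint) (auto simp: excedances_def)
  also have "sum ?w ?F = of_nat f * g (Suc p) u v (f - 1)"
    by (simp add: fixed f_def)
  finally show ?thesis
    unfolding weigh_Suc_fixed[OF perm] sum_exc sum_anti
    by (simp add: weigh_def insertion_step_def puvf algebra_simps)
qed

lemma perm_sum_Suc: "perm_sum (Suc n) g = perm_sum n (insertion_step g)"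
proof -
  let ?S = "{\<sigma>. \<sigma> permutes {1..n}}"
  have "perm_sum (Suc n) g = (\<Sum>b\<in>insert (Suc n) {1..n}.
      \<Sum>\<sigma>\<in>?S. weigh g (Suc n) (transpose (Suc n) b \<circ> \<sigma>))"
    unfolding perm_sum_def atLeastAtMost_Suc_insert
    by (rule sum_over_permutations_insert) auto
  also have "\<dots> = (\<Sum>\<sigma>\<in>?S. weigh g (Suc n) \<sigma>) +
      (\<Sum>b\<in>{1..n}. \<Sum>\<sigma>\<in>?S. weigh g (Suc n) (transpose (Suc n) b \<circ> \<sigma>))"
    by simp
  also have "(\<Sum>b\<in>{1..n}. \<Sum>\<sigma>\<in>?S. weigh g (Suc n) (transpose (Suc n) b \<circ> \<sigma>)) =
      (\<Sum>\<sigma>\<in>?S. \<Sum>b\<in>{1..n}. weigh g (Suc n) (transpose (Suc n) b \<circ> \<sigma>))"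
    by (rule sum.swap)
  also have "\<dots> = (\<Sum>\<sigma>\<in>?S. \<Sum>a\<in>{1..n}. weigh g (Suc n) (insert_max n a \<sigma>))"
    unfolding insert_max_def
    by (intro sum.cong refl sum.reindex_bij_betw[symmetric] permutes_imp_bij) auto
  also have "(\<Sum>\<sigma>\<in>?S. weigh g (Suc n) \<sigma>) + \<dots> = perm_sum n (insertion_step g)"
    unfolding perm_sum_def sum.distrib[symmetric]
    by (intro sum.cong refl sum_weigh_insert_max) auto
  finally show ?thesis .
qed

section \<open>Symmetrising over double excedances and double anti-excedances\<close>

text \<open>
  The right-hand side involves \<open>g\<close> only through its symmetrisations. This works because
  \<open>insertion_step\<close> treats \<open>u\<close> and \<open>v\<close> alike: a peak creates either kind of element once
  (Pascal's rule), and each element of either kind can turn into a valley (absorption).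
\<close>

lemma symmetrised_insertion_step:
  "binomial_sum s (\<lambda>u v. insertion_step g p u v f) =
    binomial_sum s (\<lambda>u v. g p u v (Suc f))
    + of_nat f * binomial_sum s (\<lambda>u v. g (Suc p) u v (f - 1))
    + of_nat p * binomial_sum (Suc s) (\<lambda>u v. g p u v f)
    + 2 * of_nat s * binomial_sum (s - 1) (\<lambda>u v. g (Suc p) u v f)"
  unfolding insertion_step_def binomial_sum_add binomial_sum_mult binomial_sum_Suc
    binomial_sum_absorb_left[of s "\<lambda>u v. g (Suc p) u v f"]
    binomial_sum_absorb_right[of s "\<lambda>u v. g (Suc p) u v f"]
  by (simp add: algebra_simps mult_2)

text \<open>
  Given \<open>p\<close>, \<open>f\<close> and \<open>u + v\<close>, the double excedances are distributed as by independent fair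
  choices. Stating this for weights rather than for the numbers of permutations lets the induction
  absorb the insertion into the weight.
\<close>

theorem perm_sum_symmetrised_cong:
  assumes "\<And>p s f. binomial_sum s (\<lambda>u v. g p u v f) = binomial_sum s (\<lambda>u v. h p u v f)"
  shows "perm_sum n g = perm_sum n h"
  using assms
proof (induction n arbitrary: g h)
  case 0
  show ?case using "0"[of 0 0 0] by simp
next
  case (Suc n)
  show ?case
    unfolding perm_sum_Suc
    by (rule Suc.IH) (simp only: symmetrised_insertion_step Suc.prems)
qed

section \<open>The binomial transform\<close>

text \<open>
  The weight of a permutation summed over all sets of marked fixed points, where \<open>g\<close> sees only the
  marked ones.
\<close>

definition mark_fixed ::
    "(nat \<Rightarrow> nat \<Rightarrow> nat \<Rightarrow> nat \<Rightarrow> 'a::comm_semiring_1) \<Rightarrow> nat \<Rightarrow> nat \<Rightarrow> nat \<Rightarrow> nat \<Rightarrow> 'a" where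
  "mark_fixed g p u v f = binomial_sum f (\<lambda>j _. g p u v j)"

text \<open>
  The new element \<open>n + 1\<close> is either an unmarked fixed point, which contributes \<open>g\<close> itself, or is
  inserted into the part that \<open>g\<close> sees.
\<close>

lemma insertion_step_mark_fixed:
  "insertion_step (mark_fixed g) =
    mark_fixed (\<lambda>p u v f. g p u v f + insertion_step g p u v f)"
  unfolding mark_fixed_def insertion_step_def binomial_sum_add binomial_sum_mult binomial_sum_Suc
    binomial_sum_absorb_left[of _ "\<lambda>j _. g _ _ _ j"]
  by (simp add: algebra_simps)

text \<open>
  A permutation of a subset of \<open>[n]\<close> is a permutation of \<open>[n]\<close> whose fixed points outside the subset
  are unmarked. The induction on \<open>n\<close> avoids the relabelling of the subset: both sides satisfy
  Pascal's rule.
\<close>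

theorem binomial_sum_perm_sum:
  "binomial_sum n (\<lambda>i _. perm_sum i g) = perm_sum n (mark_fixed g)"
proof (induction n arbitrary: g)
  case 0
  show ?case by (simp add: mark_fixed_def)
next
  case (Suc n)
  have "binomial_sum (Suc n) (\<lambda>i _. perm_sum i g) =
      binomial_sum n (\<lambda>i _. perm_sum i (\<lambda>p u v f. g p u v f + insertion_step g p u v f))"
    by (simp add: binomial_sum_Suc perm_sum_Suc perm_sum_add binomial_sum_add)
  also have "\<dots> = perm_sum (Suc n) (mark_fixed g)"
    by (simp add: Suc.IH perm_sum_Suc insertion_step_mark_fixed)
  finally show ?case .
qed

section \<open>The two sides as sums over permutations\<close>

lemma sum_by_value:
  fixes F :: "nat \<Rightarrow> 'b::comm_semiring_1"
  assumes "finite S" "finite K" "c ` S \<subseteq> K"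
  shows "(\<Sum>k\<in>K. of_nat (card {x \<in> S. c x = k}) * F k) = (\<Sum>x\<in>S. F (c x))"
proof -
  have "(\<Sum>k\<in>K. of_nat (card {x \<in> S. c x = k}) * F k) = (\<Sum>k\<in>K. \<Sum>x | x \<in> S \<and> c x = k. F (c x))"
    by (intro sum.cong refl) simp
  also have "\<dots> = (\<Sum>x\<in>S. F (c x))" by (rule sum.group[OF assms])
  finally show ?thesis .
qed

lemma eulerian_poly_eq:
  "eulerian_poly n = perm_sum n (\<lambda>p u v f. [:0, 1:] ^ (p + u + f))"
proof -
  let ?S = "{\<sigma>. \<sigma> permutes {1..n}}"
  have bound: "(\<lambda>\<sigma>. card (weak_excedances n \<sigma>)) ` ?S \<subseteq> {0..n}"
  proof (rule image_subsetI)
    fix \<sigma> :: "nat \<Rightarrow> nat"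
    have "card (weak_excedances n \<sigma>) \<le> card {1..n}"
      by (rule card_mono) (auto simp: weak_excedances_def)
    then show "card (weak_excedances n \<sigma>) \<in> {0..n}" by simp
  qed
  have "eulerian_poly n = (\<Sum>k=0..n.
      of_nat (card {\<sigma> \<in> ?S. card (weak_excedances n \<sigma>) = k}) * [:0, 1:] ^ k)"
    by (simp add: eulerian_poly_def eulerian_number_def monom_altdef of_nat_poly)
  also have "\<dots> = (\<Sum>\<sigma>\<in>?S. [:0, 1:] ^ card (weak_excedances n \<sigma>))"
    by (rule sum_by_value[OF _ _ bound]) (simp_all add: finite_permutations)
  also have "\<dots> = perm_sum n (\<lambda>p u v f. [:0, 1:] ^ (p + u + f))"
    unfolding perm_sum_def weigh_def
    by (intro sum.cong refl) (simp add: card_weak_excedances card_excedances)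
  finally show ?thesis .
qed

lemma binomial_eulerian_poly_eq:
  "binomial_eulerian_poly n =
    perm_sum n (\<lambda>p u v f. [:0, 1:] ^ p * [:0, 1:] ^ u * (1 + [:0, 1:]) ^ f)"
proof -
  have "binomial_eulerian_poly n =
      perm_sum n (mark_fixed (\<lambda>p u v f. [:0, 1:] ^ (p + u + f)))"
    unfolding binomial_sum_perm_sum[symmetric] binomial_eulerian_poly_def binomial_sum_def
    by (simp only: eulerian_poly_eq atLeast0AtMost)
  also have "mark_fixed (\<lambda>p u v f. [:0, 1:] ^ (p + u + f)) =
      (\<lambda>p u v f. [:0, 1:] ^ p * [:0, 1:] ^ u * (1 + [:0, 1 :: int:]) ^ f)"
  proof (intro ext)
    fix p u v f :: nat
    have "binomial_sum f (\<lambda>j _. [:0, 1 :: int:] ^ j) = ([:0, 1:] + 1) ^ f"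
      using binomial_sum_power[of f "[:0, 1 :: int:]" 1] by (simp only: power_one mult_1_right)
    then show "mark_fixed (\<lambda>p u v f. [:0, 1:] ^ (p + u + f)) p u v f =
        [:0, 1:] ^ p * [:0, 1:] ^ u * (1 + [:0, 1 :: int:]) ^ f"
      by (simp only: mark_fixed_def power_add binomial_sum_mult
          add.commute[of "[:0, 1 :: int:]" 1])
  qed
  finally show ?thesis .
qed

text \<open>
  The factor \<open>0 ^ u\<close> excludes double excedances, since \<open>0 ^ 0 = 1\<close>; written as a power, it lets the
  binomial theorem evaluate the symmetrisation. Without double excedances there are \<open>p\<close> excedances,
  and \<open>n - 2 p = v + f\<close>.
\<close>

lemma gamma_expansion_eq:
  fixes x y :: "'a::comm_semiring_1"
  shows "(\<Sum>k=0..n div 2. of_nat (gamma_coeff n k) * x ^ k * y ^ (n - 2 * k)) =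
    perm_sum n (\<lambda>p u v f. x ^ p * y ^ f * (0 ^ u * y ^ v))"
proof -
  let ?S = "{\<sigma>. \<sigma> permutes {1..n}}"
  let ?T = "{\<sigma> \<in> ?S. double_excedances n \<sigma> = {}}"
  have fin: "finite ?S" by (simp add: finite_permutations)
  have bound: "(\<lambda>\<sigma>. card (excedances n \<sigma>)) ` ?T \<subseteq> {0..n div 2}"
  proof (rule image_subsetI)
    fix \<sigma> assume "\<sigma> \<in> ?T"
    then show "card (excedances n \<sigma>) \<in> {0..n div 2}"
      using cyclic_stats_sum[of \<sigma> n] by (simp add: card_excedances)
  qed
  have "(\<Sum>k=0..n div 2. of_nat (gamma_coeff n k) * x ^ k * y ^ (n - 2 * k)) =
      (\<Sum>k=0..n div 2. of_nat (card {\<sigma> \<in> ?T. card (excedances n \<sigma>) = k})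
        * (x ^ k * y ^ (n - 2 * k)))"
    unfolding gamma_coeff_def
    by (intro sum.cong refl) (simp add: mult.assoc conj_ac)
  also have "\<dots> = (\<Sum>\<sigma>\<in>?T. x ^ card (excedances n \<sigma>) * y ^ (n - 2 * card (excedances n \<sigma>)))"
    by (rule sum_by_value[OF _ _ bound]) (use fin in auto)
  also have "\<dots> = (\<Sum>\<sigma>\<in>?T. weigh (\<lambda>p u v f. x ^ p * y ^ f * (0 ^ u * y ^ v)) n \<sigma>)"
  proof (intro sum.cong refl)
    fix \<sigma> assume \<sigma>: "\<sigma> \<in> ?T"
    then have "n - 2 * card (cyclic_peaks n \<sigma>) =
        card (fixed_points n \<sigma>) + card (double_anti_excedances n \<sigma>)"
      using cyclic_stats_sum[of \<sigma> n] by simp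
    then show "x ^ card (excedances n \<sigma>) * y ^ (n - 2 * card (excedances n \<sigma>)) =
        weigh (\<lambda>p u v f. x ^ p * y ^ f * (0 ^ u * y ^ v)) n \<sigma>"
      using \<sigma> by (simp add: weigh_def card_excedances power_add mult.assoc)
  qed
  also have "\<dots> = perm_sum n (\<lambda>p u v f. x ^ p * y ^ f * (0 ^ u * y ^ v))"
    unfolding perm_sum_def
    by (rule sum.mono_neutral_left) (auto simp: finite_permutations weigh_def zero_power card_gt_0_iff)
  finally show ?thesis .
qed

theorem theorem3p3:
  fixes n :: nat
  shows "binomial_eulerian_poly n =
    (\<Sum>k=0..n div 2. of_nat (gamma_coeff n k) * [:0, 1:] ^ k * (1 + [:0, 1:]) ^ (n - 2 * k))"
  unfolding binomial_eulerian_poly_eq gamma_expansion_eq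
proof (rule perm_sum_symmetrised_cong)
  fix p s f :: nat
  let ?x = "[:0, 1 :: int:]"
  have "binomial_sum s (\<lambda>u v. ?x ^ p * ?x ^ u * (1 + ?x) ^ f) =
      ?x ^ p * (1 + ?x) ^ f * binomial_sum s (\<lambda>u v. ?x ^ u * 1 ^ v)"
    unfolding binomial_sum_mult[symmetric] by (simp add: mult_ac)
  \<comment> \<open>Both sums are \<open>(1 + t) ^ s\<close> by the binomial theorem.\<close>
  also have "binomial_sum s (\<lambda>u v. ?x ^ u * 1 ^ v) =
      binomial_sum s (\<lambda>u v. 0 ^ u * (1 + ?x) ^ v)"
    by (simp only: binomial_sum_power add_0 add.commute)
  also have "?x ^ p * (1 + ?x) ^ f * \<dots> =
      binomial_sum s (\<lambda>u v. ?x ^ p * (1 + ?x) ^ f * (0 ^ u * (1 + ?x) ^ v))"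
    by (simp only: binomial_sum_mult)
  finally show "binomial_sum s (\<lambda>u v. ?x ^ p * ?x ^ u * (1 + ?x) ^ f) =
      binomial_sum s (\<lambda>u v. ?x ^ p * (1 + ?x) ^ f * (0 ^ u * (1 + ?x) ^ v))" .
qed

end
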